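(* Let $\alpha\in\mathbb{Q}\cap(0,1]$. Then the following dichotomy holds. (i) If $\alpha=1/b$ with $b\in\mathbb{N}$, then $\operatorname{Range}(f_\alpha)=\{0\}$. (ii) If $\alpha=a/b$ with $a,b\in\mathbb{N}$ relatively prime and $1<a<b$, then $\operatorname{Range}(f_\alpha)=\{0,1\}$.
   Context: $\mathbb{N}$ is the set of positive integers. For real $\alpha>0$, define $f_\alpha:\mathbb{N}\to\mathbb{Z}$ by $f_\alpha(n)=\lfloor\alpha^2 n\rfloor-\lfloor\alpha\lfloor\alpha n\rfloor\rfloor$, and $\operatorname{Range}(f_\alpha)=\{f_\alpha(n):n\in\mathbb{N}\}$. *)

theory Defs
  imports Complex_Main
begin

definition f :: "real \<Rightarrow> nat \<Rightarrow> int" where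
  "f \<alpha> n = \<lfloor>\<alpha>\<^sup>2 * real n\<rfloor> - \<lfloor>\<alpha> * real_of_int \<lfloor>\<alpha> * real n\<rfloor>\<rfloor>"

(* The domain of f is the set of positive integers, so 0 is excluded here. *)
definition Range_f :: "real \<Rightarrow> int set" where
  "Range_f \<alpha> = f \<alpha> ` {n. 0 < n}"

end

theory Submission
  imports Defs "HOL-Number_Theory.Cong"
begin

text \<open>
  Let \<open>\<alpha> = a / b\<close> and divide with remainder twice: \<open>a n = q b + r\<close> and \<open>a q = s b + t\<close>. Then
  \<open>a\<^sup>2 n = s b\<^sup>2 + (t b + a r)\<close>, hence \<open>f \<alpha> n = \<lfloor>(t b + a r) / b\<^sup>2\<rfloor>\<close>. As \<open>t, r < b\<close>, the value is
  0 or 1 when \<open>a \<le> b\<close>, and 0 when \<open>a = 1\<close>. The value 0 occurs at \<open>n = b\<^sup>2\<close>. When \<open>a\<close> is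
  invertible modulo \<open>b\<^sup>2\<close>, some \<open>n\<close> has \<open>t = r = b - 1\<close>, and there the value is 1 if \<open>1 < a\<close>.
\<close>

lemma f_ratio:
  assumes "0 < b"
  shows "f (real a / real b) n
    = int ((a * (a * n div b) mod b * b + a * (a * n mod b)) div (b * b))"
proof -
  define q r where "q = a * n div b" and "r = a * n mod b"
  define s t where "s = a * q div b" and "t = a * q mod b"
  have "a * (a * n) = a * (q * b + r)"
    by (simp add: q_def r_def)
  also have "\<dots> = (a * q) * b + a * r"
    by (simp add: algebra_simps)
  also have "a * q = s * b + t"
    by (simp add: s_def t_def)
  finally have "a * (a * n) = (t * b + a * r) + s * (b * b)"
    by (simp add: algebra_simps)
  \<comment> \<open>\<open>s\<close> is also the value of the nested floor (\<open>outer\<close>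
    below), so it cancels in \<open>f\<close> and only the second quotient survives.\<close>
  then have split: "a * (a * n) div (b * b) = s + (t * b + a * r) div (b * b)"
    using assms by simp
  have "(real a / real b)\<^sup>2 * real n = real (a * (a * n)) / real (b * b)"
    by (simp add: power2_eq_square)
  then have square: "\<lfloor>(real a / real b)\<^sup>2 * real n\<rfloor> = int (a * (a * n) div (b * b))"
    by (simp only: floor_divide_of_nat_eq)
  have "real a / real b * real n = real (a * n) / real b"
    by simp
  then have inner: "\<lfloor>real a / real b * real n\<rfloor> = int q"
    unfolding q_def by (simp only: floor_divide_of_nat_eq)
  have "real a / real b * real_of_int (int q) = real (a * q) / real b"
    by simp
  then have outer: "\<lfloor>real a / real b * real_of_int (int q)\<rfloor> = int s"
    unfolding s_def by (simp only: floor_divide_of_nat_eq)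
  show ?thesis
    unfolding f_def square inner outer split by (simp add: t_def q_def r_def)
qed

lemma f_ratio_in_01:
  assumes "0 < b" "a \<le> b"
  shows "f (real a / real b) n \<in> {0, 1}"
proof -
  define r t where "r = a * n mod b" and "t = a * (a * n div b) mod b"
  have "Suc t \<le> b"
    using assms by (simp add: t_def Suc_leI)
  then have "Suc t * b \<le> b * b"
    by (rule mult_le_mono1)
  \<comment> \<open>Each of \<open>t * b\<close> and \<open>a * r\<close> stays below
    \<open>b * b\<close>, the latter because \<open>a \<le> b\<close>.\<close>
  moreover have "a * r \<le> b * r" "b * r < b * b"
    using assms by (auto simp: r_def)
  ultimately have "t * b + a * r < 2 * (b * b)"
    unfolding mult_Suc by linarith
  then have "(t * b + a * r) div (b * b) < 2"
    by (rule less_mult_imp_div_less)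
  then show ?thesis
    unfolding f_ratio[OF assms(1)] r_def[symmetric] t_def[symmetric] by auto
qed

text \<open>For \<open>a = 1\<close> the numerator \<open>t * b + r\<close> is a two-digit number in
  base \<open>b\<close>, hence below \<open>b * b\<close>.\<close>

lemma f_unit_fraction:
  assumes "0 < b"
  shows "f (1 / real b) n = 0"
proof -
  define r t where "r = n mod b" and "t = n div b mod b"
  have "Suc t \<le> b" "r < b"
    using assms by (simp_all add: r_def t_def Suc_leI)
  moreover from this(1) have "Suc t * b \<le> b * b"
    by (rule mult_le_mono1)
  ultimately have "t * b + r < b * b"
    by simp
  then show ?thesis
    using f_ratio[OF assms, of 1 n] by (simp add: r_def t_def)
qed

text \<open>Two factors \<open>b\<close> in the argument let both successive divisions by
  \<open>b\<close> come out exact.\<close>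

lemma f_ratio_square:
  assumes "0 < b"
  shows "f (real a / real b) (b * b) = 0"
proof -
  have "a * (b * b) div b = a * b"
    using assms by (simp flip: mult.assoc)
  then show ?thesis
    using f_ratio[OF assms, of a "b * b"] by (simp flip: mult.assoc)
qed

text \<open>The two lowest base-\<open>b\<close> digits of \<open>a * n\<close> determine both
  remainders. Inverting \<open>a\<close> modulo \<open>b * b\<close>, and not just modulo
  \<open>b\<close>, lets both digits be prescribed.\<close>

lemma ex_f_ratio_eq_1:
  assumes "coprime a b" "1 < a" "1 < b" "a \<le> b"
  shows "\<exists>n>0. f (real a / real b) n = 1"
proof -
  have "coprime a (b * b)"
    using assms by simp
  then obtain x where x: "[a * x = 1] (mod b * b)"
    using cong_solve_coprime_nat by fastforce
  then have x_b: "[a * x = 1] (mod b)"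
    using cong_dvd_modulus_nat dvd_triv_left by blast
  \<comment> \<open>\<open>p\<close> solves \<open>a * p = b - 1\<close> modulo \<open>b\<close>,
    which makes \<open>t\<close> maximal; the last digit \<open>b - 1\<close> of \<open>v\<close>
    makes \<open>r\<close> maximal.\<close>
  define p where "p = (b - 1) * x"
  define v where "v = p * b + (b - 1)"
  have v: "v div b = p" "v mod b = b - 1"
    using assms by (simp_all only: v_def div_mult_self3 mod_mult_self3) simp_all
  define n where "n = x * v"
  have "[a * n = v] (mod b * b)"
    using cong_mult[OF x cong_refl[of v]] by (simp add: n_def mult.assoc)
  then have mod_bb: "a * n mod (b * b) = v mod (b * b)"
    by (simp add: cong_def)
  then have "a * n mod (b * b) mod b = v mod (b * b) mod b"
    by simp
  then have r: "a * n mod b = b - 1"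
    by (simp add: mod_mod_cancel v)
  \<comment> \<open>\<open>mod_mult2_eq\<close> splits both sides of \<open>mod_bb\<close> into
    digits; the equal last digits cancel.\<close>
  have "b * (a * n div b mod b) = b * (p mod b)"
    using mod_bb unfolding mod_mult2_eq r v by (rule add_right_imp_eq)
  then have "[a * n div b = p] (mod b)"
    using assms by (simp add: cong_def)
  then have "[a * (a * n div b) = a * p] (mod b)"
    by (rule cong_scalar_left)
  also have "[a * p = b - 1] (mod b)"
    using cong_mult[OF x_b cong_refl[of "b - 1"]] by (simp add: p_def ac_simps)
  finally have t: "a * (a * n div b) mod b = b - 1"
    using assms by (simp add: cong_def)
  \<comment> \<open>The numerator reaches \<open>b * b\<close> exactly when
    \<open>a * (b - 1)\<close> is at least \<open>b\<close>; this follows from \<open>a\<close> and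
    \<open>b\<close> being at least 2.\<close>
  have "b \<le> 2 * (b - 1)"
    using assms by simp
  also have "\<dots> \<le> a * (b - 1)"
    using assms by (intro mult_le_mono1) simp
  finally have "b * b \<le> (b - 1) * b + a * (b - 1)"
    by (simp add: diff_mult_distrib)
  then have "f (real a / real b) n \<noteq> 0"
    using assms by (simp add: f_ratio r t div_eq_0_iff)
  then have "f (real a / real b) n = 1"
    using f_ratio_in_01[of b a n] assms by simp
  \<comment> \<open>At \<open>n = 0\<close> the remainder would be 0 instead of
    \<open>b - 1\<close>.\<close>
  moreover have "0 < n"
    using r assms by (cases n) auto
  ultimately show ?thesis by blast
qed

theorem proposition3p4:
  fixes \<alpha> :: real
  assumes "\<alpha> \<in> \<rat> \<inter> {0<..1}"
  shows "((\<exists>b::nat. 0 < b \<and> \<alpha> = 1 / real b) \<or>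
          (\<exists>a b::nat. coprime a b \<and> 1 < a \<and> a < b \<and> \<alpha> = real a / real b))
       \<and> (\<forall>b::nat. 0 < b \<and> \<alpha> = 1 / real b \<longrightarrow> Range_f \<alpha> = {0})
       \<and> (\<forall>a b::nat. coprime a b \<and> 1 < a \<and> a < b \<and> \<alpha> = real a / real b
            \<longrightarrow> Range_f \<alpha> = {0, 1})"
proof (intro conjI allI impI)
  have \<alpha>: "\<alpha> \<in> \<rat>" "0 < \<alpha>" "\<alpha> \<le> 1"
    using assms by auto
  from \<alpha>(1) obtain a b :: nat where ab: "b \<noteq> 0" "\<bar>\<alpha>\<bar> = real a / real b" "coprime a b"
    by (rule Rats_abs_nat_div_natE)
  then have eq: "\<alpha> = real a / real b"
    using \<alpha> by simp
  then have "0 < a" "a \<le> b"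
    using \<alpha>(2,3) ab(1) by (simp_all add: zero_less_divide_iff)
  \<comment> \<open>The endpoint \<open>\<alpha> = 1\<close> thus falls under the unit
    fractions.\<close>
  moreover have "a = 1" if "a = b"
    using ab(3) that by simp
  ultimately have "a = 1 \<or> 1 < a \<and> a < b"
    by linarith
  then show "(\<exists>b::nat. 0 < b \<and> \<alpha> = 1 / real b) \<or>
    (\<exists>a b::nat. coprime a b \<and> 1 < a \<and> a < b \<and> \<alpha> = real a / real b)"
    using ab eq by auto
next
  fix b :: nat
  assume "0 < b \<and> \<alpha> = 1 / real b"
  then show "Range_f \<alpha> = {0}"
    by (auto simp: Range_f_def f_unit_fraction image_constant_conv)
next
  fix a b :: nat
  assume ab: "coprime a b \<and> 1 < a \<and> a < b \<and> \<alpha> = real a / real b"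
  then have "Range_f \<alpha> \<subseteq> {0, 1}"
    using f_ratio_in_01[of b a] by (auto simp: Range_f_def)
  moreover have "0 \<in> Range_f \<alpha>"
    unfolding Range_f_def
    by (rule image_eqI[where x = "b * b"]) (use ab f_ratio_square[of b a] in auto)
  moreover have "1 \<in> Range_f \<alpha>"
    using ex_f_ratio_eq_1[of a b] ab by (force simp: Range_f_def)
  ultimately show "Range_f \<alpha> = {0, 1}"
    by blast
qed

end
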